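(* Let $H$ be a real Hilbert space, let $g:H\to\mathbb{R}\cup\{+\infty\}$ be proper, convex and lower semicontinuous, let $h:H\to\mathbb{R}$ be convex and differentiable, and let $f:=g-h$. Suppose that $f$ is bounded below, that $\nabla h$ is (single-valued and) uniformly continuous on $H$, that $S:=(\partial g-\nabla h)^{-1}(0)\neq\emptyset$, and that $(\partial g-\nabla h)^{-1}$ is $R$-continuous at $0$ with modulus function $\rho$. Let $\gamma>0$, $x_0\in H$, and let $(x_k)$ be the sequence generated by the forward-backward splitting algorithm $$x_{k+1}=(Id+\gamma\,\partial g)^{-1}\bigl(x_k+\gamma\nabla h(x_k)\bigr),\qquad k=0,1,2,\dots$$ Then $\lim_{k\to+\infty}d(x_k,S)=0$.
   Context: $\partial g$ is the subdifferential of convex analysis; $(\partial g-\nabla h)(x)=\{v-\nabla h(x): v\in\partial g(x)\}$ and, for a set-valued map $T$, $T^{-1}(y)=\{x: y\in T(x)\}$. $d(x,S)=\inf_{s\in S}\Vert x-s\Vert$; $\mathbb{B}$ is the closed unit ball of $H$; $\mathbb{R}^+=[0,\infty)$. A set-valued operator $\mathcal{A}:H\rightrightarrows H$ with $\mathcal{A}(0)\ne\emptyset$ is called $R$-continuous at $0$ with modulus function $\rho$ if there exist $\sigma>0$ and a non-decreasing function $\rho:\mathbb{R}^+\to\mathbb{R}^+$ with $\lim_{r\to0^+}\rho(r)=\rho(0)=0$ such that $\mathcal{A}(x)\subset\mathcal{A}(0)+\rho(\Vert x\Vert)\mathbb{B}$ for all $x\in\sigma\mathbb{B}$. *)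

theory Defs
  imports "HOL-Analysis.Analysis"
begin

definition proper_fun :: "('a \<Rightarrow> ereal) \<Rightarrow> bool" where
  "proper_fun g \<longleftrightarrow> (\<forall>x. g x \<noteq> -\<infinity>) \<and> (\<exists>x. g x \<noteq> \<infinity>)"

(* Intended for functions that never take the value -\<infinity>.
   The extended arithmetic has 0 * \<infinity> = 0, so u = 0 and v = 0 impose nothing. *)
definition convex_ereal :: "('a::real_vector \<Rightarrow> ereal) \<Rightarrow> bool" where
  "convex_ereal g \<longleftrightarrow>
     (\<forall>x y. \<forall>u\<ge>0. \<forall>v\<ge>0. u + v = 1 \<longrightarrow>
        g (u *\<^sub>R x + v *\<^sub>R y) \<le> ereal u * g x + ereal v * g y)"

definition lsc :: "('a::topological_space \<Rightarrow> ereal) \<Rightarrow> bool" where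
  "lsc g \<longleftrightarrow> (\<forall>x. g x \<le> Liminf (at x) g)"

definition subdiff :: "('a::real_inner \<Rightarrow> ereal) \<Rightarrow> 'a \<Rightarrow> 'a set" where
  "subdiff g x = {v. \<forall>y. g x + ereal (v \<bullet> (y - x)) \<le> g y}"

definition set_inverse :: "('a \<Rightarrow> 'b set) \<Rightarrow> 'b \<Rightarrow> 'a set" where
  "set_inverse T y = {x. y \<in> T x}"

definition R_continuous_at_0 ::
  "('a::real_normed_vector \<Rightarrow> 'b::real_normed_vector set) \<Rightarrow> (real \<Rightarrow> real) \<Rightarrow> bool" where
  "R_continuous_at_0 A \<rho> \<longleftrightarrow>
     A 0 \<noteq> {} \<and>
     (\<forall>r\<ge>0. 0 \<le> \<rho> r) \<and> mono_on {0..} \<rho> \<and> \<rho> 0 = 0 \<and> (\<rho> \<longlongrightarrow> 0) (at_right 0) \<and>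
     (\<exists>\<sigma>>0. \<forall>x\<in>cball 0 \<sigma>. A x \<subseteq> {a + \<rho> (norm x) *\<^sub>R b | a b. a \<in> A 0 \<and> b \<in> cball 0 1})"

end

theory Submission
  imports Defs
begin

text \<open>
  One forward-backward step from \<open>u\<close> to \<open>p\<close> produces a subgradient of \<open>g\<close> at \<open>p\<close>, namely
  \<open>\<nabla>h(u) + (u - p) / \<gamma>\<close>. Adding the subgradient inequality of \<open>g\<close> at \<open>p\<close> to the
  gradient inequality of \<open>h\<close> at \<open>u\<close> shows that \<open>g - h\<close> drops by at least
  \<open>\<parallel>u - p\<parallel>\<^sup>2 / \<gamma>\<close> (lemma \<open>forward_backward_descent\<close>), for every step size. Since
  \<open>g - h\<close> is bounded below, the steps \<open>x\<^sub>k - x\<^sub>k\<^sub>+\<^sub>1\<close> tend to \<open>0\<close>.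

  The same subgradient shows that the residual
  \<open>(x\<^sub>k - x\<^sub>k\<^sub>+\<^sub>1) / \<gamma> + \<nabla>h(x\<^sub>k) - \<nabla>h(x\<^sub>k\<^sub>+\<^sub>1)\<close> belongs to \<open>(\<partial>g - \<nabla>h)(x\<^sub>k\<^sub>+\<^sub>1)\<close>. Uniform
  continuity of \<open>\<nabla>h\<close>, applied to iterates that may be unbounded, makes the residual tend
  to \<open>0\<close>, and R-continuity of the inverse operator turns a small residual into a
  small distance from the solution set (lemma \<open>R_continuous_at_0_infdist_tendsto\<close>).
\<close>

text \<open>
  On the line through \<open>u\<close> and \<open>w\<close> this is the one-dimensional tangent inequality.
\<close>

lemma convex_on_gradient_inequality:
  fixes h :: "'a::real_inner \<Rightarrow> real"
  assumes "convex_on UNIV h" and "GDERIV h u :> d"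
  shows "h u + d \<bullet> (w - u) \<le> h w"
proof -
  define \<phi> where "\<phi> t = h (u + t *\<^sub>R (w - u))" for t :: real
  have convex: "convex_on UNIV \<phi>"
  proof (rule convex_onI)
    fix t a b :: real
    assume "0 < t" "t < 1"
    have "u + ((1 - t) *\<^sub>R a + t *\<^sub>R b) *\<^sub>R (w - u) =
        (1 - t) *\<^sub>R (u + a *\<^sub>R (w - u)) + t *\<^sub>R (u + b *\<^sub>R (w - u))"
      by (simp add: algebra_simps)
    then show "\<phi> ((1 - t) *\<^sub>R a + t *\<^sub>R b) \<le> (1 - t) * \<phi> a + t * \<phi> b"
      using convex_onD[OF assms(1), of t] \<open>0 < t\<close> \<open>t < 1\<close>
      unfolding \<phi>_def by auto
  qed simp
  have h_deriv: "(h has_derivative (\<lambda>z. z \<bullet> d)) (at (u + 0 *\<^sub>R (w - u)))"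
    using assms(2) by (simp add: gderiv_def)
  have "((\<lambda>t::real. u + t *\<^sub>R (w - u)) has_derivative (\<lambda>t. t *\<^sub>R (w - u))) (at 0)"
    by (auto intro!: derivative_eq_intros)
  from has_derivative_compose[OF this h_deriv]
  have "(\<phi> has_real_derivative d \<bullet> (w - u)) (at 0)"
    unfolding \<phi>_def has_field_derivative_def
    by (simp add: inner_commute mult.commute[of _ "d \<bullet> (w - u)"] mult_commute_abs)
  then have "\<phi> 1 - \<phi> 0 \<ge> (d \<bullet> (w - u)) * (1 - 0)"
    by (intro convex_on_imp_above_tangent[OF convex]) auto
  then show ?thesis
    by (simp add: \<phi>_def)
qed

text \<open>
  Testing the subgradient inequality at a point where \<open>g\<close> is finite bounds \<open>g x\<close> from above.
\<close>

lemma subdiff_imp_finite: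
  assumes "proper_fun g" and "v \<in> subdiff g x"
  shows "\<bar>g x\<bar> \<noteq> \<infinity>"
proof -
  obtain y where "g y \<noteq> \<infinity>"
    using assms(1) by (auto simp: proper_fun_def)
  moreover have "g x + ereal (v \<bullet> (y - x)) \<le> g y"
    using assms(2) by (simp add: subdiff_def)
  ultimately have "g x \<noteq> \<infinity>"
    by auto
  then show ?thesis
    using assms(1) by (auto simp: proper_fun_def)
qed

text \<open>
  The update makes \<open>\<gamma> (v - d) = u - p\<close>, so that the linear terms of the two
  first-order inequalities combine to the square of the step length.
\<close>

lemma forward_backward_descent:
  fixes g :: "'a::real_inner \<Rightarrow> ereal"
  assumes "convex_on UNIV h" and "GDERIV h u :> d" and "\<gamma> > 0"
    and "v \<in> subdiff g p" and step: "p + \<gamma> *\<^sub>R v = u + \<gamma> *\<^sub>R d"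
    and "\<bar>g p\<bar> \<noteq> \<infinity>" and "\<bar>g u\<bar> \<noteq> \<infinity>"
  shows "(norm (u - p))\<^sup>2 / \<gamma> \<le> (real_of_ereal (g u) - h u) - (real_of_ereal (g p) - h p)"
proof -
  have "g p + ereal (v \<bullet> (u - p)) \<le> g u"
    using assms(4) by (simp add: subdiff_def)
  then have g_ineq: "real_of_ereal (g p) + v \<bullet> (u - p) \<le> real_of_ereal (g u)"
    using assms(6,7) by (cases "g p"; cases "g u") auto
  have h_ineq: "h u + d \<bullet> (p - u) \<le> h p"
    using assms(1,2) by (rule convex_on_gradient_inequality)
  have "u - p = \<gamma> *\<^sub>R (v - d)"
    using step by (simp add: algebra_simps)
  then have "(u - p) \<bullet> (u - p) = \<gamma> * ((v - d) \<bullet> (u - p))"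
    by (metis inner_scaleR_left)
  then have "(norm (u - p))\<^sup>2 / \<gamma> = (v - d) \<bullet> (u - p)"
    using \<open>\<gamma> > 0\<close> by (simp add: power2_norm_eq_inner)
  also have "\<dots> = v \<bullet> (u - p) + d \<bullet> (p - u)"
    by (simp add: inner_diff_left inner_diff_right)
  finally show ?thesis
    using g_ineq h_ineq by linarith
qed

text \<open>
  A nonincreasing sequence that is bounded below converges, so its decrements vanish in the limit.
\<close>

lemma tendsto_0_if_le_decrement:
  fixes a F :: "nat \<Rightarrow> real"
  assumes nonneg: "\<And>k. 0 \<le> a k" and decrement: "\<And>k. a k \<le> F k - F (Suc k)"
    and bounded: "\<And>k. m \<le> F k"
  shows "a \<longlonglongrightarrow> 0"
proof -
  have "decseq F"
    by (rule decseq_SucI) (smt (verit) nonneg decrement)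
  then obtain L where L: "F \<longlonglongrightarrow> L"
    using decseq_convergent bounded by metis
  then have "(\<lambda>k. F k - F (Suc k)) \<longlonglongrightarrow> L - L"
    by (intro tendsto_diff LIMSEQ_Suc)
  then show ?thesis
    using nonneg decrement by (intro tendsto_sandwich[of "\<lambda>_. 0" a]) auto
qed

text \<open>
  Once \<open>y k\<close> is in the ball of radius \<open>\<sigma>\<close>, the inclusion gives
  \<open>infdist (p k) (A 0) \<le> \<rho> (norm (y k))\<close>.
\<close>

lemma R_continuous_at_0_infdist_tendsto:
  fixes A :: "'a::real_normed_vector \<Rightarrow> 'b::real_normed_vector set"
  assumes A: "R_continuous_at_0 A \<rho>" and y: "y \<longlonglongrightarrow> 0" and p: "\<And>k. p k \<in> A (y k)"
  shows "(\<lambda>k. infdist (p k) (A 0)) \<longlonglongrightarrow> 0"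
proof -
  obtain \<sigma> where "\<sigma> > 0" and incl:
    "\<And>z. z \<in> cball 0 \<sigma> \<Longrightarrow> A z \<subseteq> {a + \<rho> (norm z) *\<^sub>R b | a b. a \<in> A 0 \<and> b \<in> cball 0 1}"
    using A unfolding R_continuous_at_0_def by blast
  have \<rho>: "\<rho> r \<ge> 0" if "r \<ge> 0" for r
    using A that by (auto simp: R_continuous_at_0_def)
  (* The value at 0 is needed as well as the limit: residuals may vanish exactly. *)
  have "continuous (at 0 within {0..}) \<rho>"
    using A by (simp add: R_continuous_at_0_def continuous_within at_within_Ici_at_right)
  moreover have "(\<lambda>k. norm (y k)) \<longlonglongrightarrow> 0"
    using y by (rule tendsto_norm_zero)
  ultimately have "(\<lambda>k. \<rho> (norm (y k))) \<longlonglongrightarrow> \<rho> 0"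
    by (intro continuous_within_tendsto_compose[of 0 "{0..}" \<rho>]) auto
  then have \<rho>_lim: "(\<lambda>k. \<rho> (norm (y k))) \<longlonglongrightarrow> 0"
    using A by (simp add: R_continuous_at_0_def)
  have "eventually (\<lambda>k. y k \<in> ball 0 \<sigma>) sequentially"
    using y \<open>\<sigma> > 0\<close> by (intro topological_tendstoD) auto
  then have bound: "eventually (\<lambda>k. infdist (p k) (A 0) \<le> \<rho> (norm (y k))) sequentially"
  proof eventually_elim
    case (elim k)
    then obtain a b where "p k = a + \<rho> (norm (y k)) *\<^sub>R b" "a \<in> A 0" "norm b \<le> 1"
      using incl[of "y k"] p[of k] by auto
    moreover from this have "dist (p k) a \<le> \<rho> (norm (y k))"
      using \<rho>[of "norm (y k)"] by (simp add: dist_norm mult_left_le)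
    ultimately show ?case
      using infdist_le2 by blast
  qed
  show ?thesis
    by (rule tendsto_sandwich[OF _ bound tendsto_const \<rho>_lim]) (simp add: infdist_nonneg)
qed

theorem theorem3:
  fixes g f :: "'a::{real_inner, complete_space} \<Rightarrow> ereal"
    and h :: "'a \<Rightarrow> real"
    and grad_h :: "'a \<Rightarrow> 'a"
    and S :: "'a set"
    and \<rho> :: "real \<Rightarrow> real"
    and \<gamma> :: real
    and x0 :: 'a
    and x :: "nat \<Rightarrow> 'a"
  assumes "proper_fun g" and "convex_ereal g" and "lsc g"
    and "convex_on UNIV h"
    and "\<And>u. GDERIV h u :> grad_h u"
    and "f = (\<lambda>u. g u - ereal (h u))"
    and "\<exists>m::real. \<forall>u. ereal m \<le> f u"
    and "uniformly_continuous_on UNIV grad_h"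
    and "S = set_inverse (\<lambda>u. {v - grad_h u | v. v \<in> subdiff g u}) 0"
    and "S \<noteq> {}"
    and "R_continuous_at_0 (set_inverse (\<lambda>u. {v - grad_h u | v. v \<in> subdiff g u})) \<rho>"
    and "\<gamma> > 0"
    and "x 0 = x0"
    and "\<And>k. x (Suc k) \<in>
           set_inverse (\<lambda>u. {u + \<gamma> *\<^sub>R v | v. v \<in> subdiff g u}) (x k + \<gamma> *\<^sub>R grad_h (x k))"
  shows "(\<lambda>k. infdist (x k) S) \<longlonglongrightarrow> 0"
proof -
  let ?T = "\<lambda>u. {v - grad_h u | v. v \<in> subdiff g u}"
  define v where "v k = grad_h (x k) + (1 / \<gamma>) *\<^sub>R (x k - x (Suc k))" for k
  have v_subgradient: "v k \<in> subdiff g (x (Suc k))"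
    and step: "x (Suc k) + \<gamma> *\<^sub>R v k = x k + \<gamma> *\<^sub>R grad_h (x k)" for k
  proof -
    show "x (Suc k) + \<gamma> *\<^sub>R v k = x k + \<gamma> *\<^sub>R grad_h (x k)"
      using \<open>\<gamma> > 0\<close> by (simp add: v_def algebra_simps)
    moreover obtain w where "w \<in> subdiff g (x (Suc k))"
      and "x (Suc k) + \<gamma> *\<^sub>R w = x k + \<gamma> *\<^sub>R grad_h (x k)"
      using assms(14)[of k] by (auto simp: set_inverse_def)
    ultimately show "v k \<in> subdiff g (x (Suc k))"
      using \<open>\<gamma> > 0\<close> by (metis add_left_cancel less_irrefl real_vector.scale_left_imp_eq)
  qed
  have finite: "\<bar>g (x (Suc k))\<bar> \<noteq> \<infinity>" for k
    using assms(1) v_subgradient by (rule subdiff_imp_finite)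

  (* The starting point may lie outside the domain of g, so energies are taken from x 1 onwards. *)
  define F where "F k = real_of_ereal (g (x (Suc k))) - h (x (Suc k))" for k
  obtain m :: real where m: "\<And>u. ereal m \<le> g u - ereal (h u)"
    using assms(6,7) by auto
  have F_bounded: "m \<le> F k" for k
    using m[of "x (Suc k)"] finite[of k] unfolding F_def by (cases "g (x (Suc k))") auto
  have "(norm (x (Suc k) - x (Suc (Suc k))))\<^sup>2 / \<gamma> \<le> F k - F (Suc k)" for k
    unfolding F_def
    using assms(4) assms(5) assms(12) v_subgradient step finite finite
    by (rule forward_backward_descent)
  then have "(\<lambda>k. (norm (x (Suc k) - x (Suc (Suc k))))\<^sup>2 / \<gamma>) \<longlonglongrightarrow> 0"
    using F_bounded \<open>\<gamma> > 0\<close> by (intro tendsto_0_if_le_decrement[of _ F m]) auto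
  then have "(\<lambda>k. \<gamma> * ((norm (x (Suc k) - x (Suc (Suc k))))\<^sup>2 / \<gamma>)) \<longlonglongrightarrow> 0"
    by (rule tendsto_mult_right_zero)
  then have "(\<lambda>k. x (Suc k) - x (Suc (Suc k))) \<longlonglongrightarrow> 0"
    using \<open>\<gamma> > 0\<close> by (simp add: tendsto_norm_zero_iff)
  then have steps: "(\<lambda>k. x k - x (Suc k)) \<longlonglongrightarrow> 0"
    by (rule LIMSEQ_imp_Suc)

  have "(\<lambda>k. dist (grad_h (x k)) (grad_h (x (Suc k)))) \<longlonglongrightarrow> 0"
    using assms(8) steps
    by (auto simp: uniformly_continuous_on_sequentially dist_norm tendsto_norm_zero_iff)
  then have gradients: "(\<lambda>k. grad_h (x k) - grad_h (x (Suc k))) \<longlonglongrightarrow> 0"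
    by (simp add: dist_norm tendsto_norm_zero_iff)
  have "(\<lambda>k. (grad_h (x k) - grad_h (x (Suc k))) + (1 / \<gamma>) *\<^sub>R (x k - x (Suc k))) \<longlonglongrightarrow>
      0 + (1 / \<gamma>) *\<^sub>R 0"
    by (intro tendsto_intros gradients steps)
  then have residuals: "(\<lambda>k. v k - grad_h (x (Suc k))) \<longlonglongrightarrow> 0"
    by (simp add: v_def algebra_simps)
  have "x (Suc k) \<in> set_inverse ?T (v k - grad_h (x (Suc k)))" for k
    using v_subgradient by (auto simp: set_inverse_def)
  with assms(11) residuals have "(\<lambda>k. infdist (x (Suc k)) (set_inverse ?T 0)) \<longlonglongrightarrow> 0"
    by (rule R_continuous_at_0_infdist_tendsto)
  then show ?thesis
    unfolding assms(9) by (rule LIMSEQ_imp_Suc)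
qed

end
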